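(* $$\lim_{B\to\infty}\frac{\#\mathcal{G}_3(B)}{\#\mathcal{P}(B)}=\frac{1}{3}.$$
   Context: For $B>0$ define the finite sets $$\mathcal{P}(B)=\{(r,s)\in\mathbb{Z}^2:\ \gcd(r,s)=1,\ 0<s<r,\ r\leq B\},$$ $$\mathcal{G}_3(B)=\{(k,m)\in\mathbb{Z}^2:\ \gcd(k,m)=1,\ 0<m<k\leq B,\ m\equiv 1 \pmod 2,\ k\equiv 0 \pmod 2\}.$$ Here $\#$ denotes cardinality. *)

theory Defs
  imports Complex_Main "HOL-Number_Theory.Number_Theory"
begin

definition P_set :: "real \<Rightarrow> (int \<times> int) set" where
  "P_set B = {(r, s). gcd r s = 1 \<and> 0 < s \<and> s < r \<and> real_of_int r \<le> B}"

definition G3_set :: "real \<Rightarrow> (int \<times> int) set" where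
  "G3_set B = {(k, m). gcd k m = 1 \<and> 0 < m \<and> m < k \<and> real_of_int k \<le> B \<and>
     [m = 1] (mod 2) \<and> [k = 0] (mod 2)}"

text \<open>Both sets are finite, so that \<^const>\<open>card\<close> is the genuine cardinality.\<close>

lemma finite_P_set: "finite (P_set B)"
proof (rule finite_subset)
  show "P_set B \<subseteq> {0..\<lfloor>B\<rfloor>} \<times> {0..\<lfloor>B\<rfloor>}"
    by (auto simp: P_set_def le_floor_iff)
qed simp

lemma finite_G3_set: "finite (G3_set B)"
  by (rule finite_subset[OF _ finite_P_set[of B]]) (auto simp: P_set_def G3_set_def)

end

theory Submission
  imports Defs
begin

text \<open>
  The map \<open>p \<mapsto> d p\<close>, for \<open>d\<close> odd, changes neither the parity of \<open>k\<close> nor that of \<open>m\<close>. Sorting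
  the pairs \<open>0 < m < k \<le> B\<close> that are not both even by their gcd, which is odd, therefore
  writes their number as the sum of \<open>#P(B/d)\<close> over odd \<open>d\<close>, and the number of those with \<open>k\<close>
  even as the sum of \<open>#G\<^sub>3(B/d)\<close>: a coprime pair with \<open>k\<close> even has \<open>m\<close> odd. The left-hand
  sides involve no coprimality and can be counted exactly, and the pairs with \<open>k\<close> even make up
  a third of the total up to an error of at most \<open>B\<close>.

  Put \<open>h(B) = 3 #G\<^sub>3(B) - #P(B)\<close>. The two identities give \<open>\<Sum> h(B/d) = O(B)\<close>, the sum running
  over odd \<open>d\<close>, and hence \<open>|h(B)| \<le> B + \<Sum> |h(B/d)|\<close> with \<open>d\<close> now odd and at least 3. Since the
  sum of \<open>d\<^sup>-\<^sup>3\<^sup>/\<^sup>2\<close> over these \<open>d\<close> is less than 1, induction on the integer part of \<open>B\<close> yields \<open>h(B) = O(B\<^sup>3\<^sup>/\<^sup>2)\<close>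
  (\<open>abs_defect_le\<close>). The recursion for \<open>#P\<close>, with every \<open>#P(B/d)\<close> for \<open>d \<ge> 3\<close> bounded by the
  number of all pairs up to \<open>B/d\<close> that are not both even, shows that \<open>#P(B)\<close> is at least a constant times \<open>B\<^sup>2\<close> (\<open>card_P_set_ge\<close>). So
  \<open>#G\<^sub>3(B)/#P(B) - 1/3 = h(B)/(3 #P(B))\<close> is \<open>O(B\<^sup>-\<^sup>1\<^sup>/\<^sup>2)\<close>.
\<close>

section \<open>Sorting pairs by an odd greatest common divisor\<close>

definition odd_gcd_pairs :: "real \<Rightarrow> (int \<times> int) set" where
  "odd_gcd_pairs B = {(k, m). odd (gcd k m) \<and> 0 < m \<and> m < k \<and> real_of_int k \<le> B}"

text \<open>
  A pair with gcd \<open>d = 2 j + 1\<close> is \<open>d\<close> times a coprime pair with larger entry at most \<open>B / d\<close>.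
  A gcd exceeding \<open>B\<close> cannot occur, so any \<open>M \<ge> B / 2\<close> may truncate the sum. The predicate \<open>Q\<close>
  stands for a parity condition on the larger entry.
\<close>

lemma card_odd_gcd_pairs_by_gcd:
  fixes B :: real and M :: nat and Q :: "int \<Rightarrow> bool"
  assumes Q: "\<And>c k. odd c \<Longrightarrow> Q (c * k) \<longleftrightarrow> Q k" and M: "B \<le> 2 * real M"
  shows "card {p \<in> odd_gcd_pairs B. Q (fst p)} =
    (\<Sum>j<M. card {p \<in> P_set (B / (2 * real j + 1)). Q (fst p)})"
proof -
  define S where "S j = {p \<in> P_set (B / (2 * real j + 1)). Q (fst p)}" for j :: nat
  define f :: "nat \<times> int \<times> int \<Rightarrow> int \<times> int" where
    "f = (\<lambda>(j, k, m). ((2 * int j + 1) * k, (2 * int j + 1) * m))"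
  have gcd_f: "gcd ((2 * int j + 1) * k) ((2 * int j + 1) * m) = 2 * int j + 1"
    if "(k, m) \<in> S j" for j k m
    using that by (simp add: S_def P_set_def gcd_mult_distrib_int [symmetric])
  have "bij_betw f (SIGMA j:{..<M}. S j) {p \<in> odd_gcd_pairs B. Q (fst p)}"
  proof (rule bij_betw_imageI)
    show "inj_on f (SIGMA j:{..<M}. S j)"
    proof (rule inj_onI)
      fix x y
      assume x: "x \<in> (SIGMA j:{..<M}. S j)" and y: "y \<in> (SIGMA j:{..<M}. S j)" and eq: "f x = f y"
      obtain j k m where x': "x = (j, k, m)" by (cases x)
      obtain j' k' m' where y': "y = (j', k', m')" by (cases y)
      have "2 * int j + 1 = 2 * int j' + 1"
        using gcd_f[of k m j] gcd_f[of k' m' j'] x y eq by (simp add: x' y' f_def)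
      then show "x = y" using eq by (auto simp: x' y' f_def)
    qed
    show "f ` (SIGMA j:{..<M}. S j) = {p \<in> odd_gcd_pairs B. Q (fst p)}"
    proof (intro subset_antisym subsetI)
      fix p assume "p \<in> f ` (SIGMA j:{..<M}. S j)"
      then obtain j k m where km: "(k, m) \<in> S j"
        and p: "p = ((2 * int j + 1) * k, (2 * int j + 1) * m)"
        by (auto simp: f_def)
      have "real_of_int k * (2 * real j + 1) \<le> B"
        using km by (simp add: S_def P_set_def pos_le_divide_eq)
      then show "p \<in> {p \<in> odd_gcd_pairs B. Q (fst p)}"
        using km gcd_f[OF km] Q[of "2 * int j + 1" k]
        by (auto simp: p S_def P_set_def odd_gcd_pairs_def mult.commute)
    next
      fix p assume p: "p \<in> {p \<in> odd_gcd_pairs B. Q (fst p)}"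
      obtain k m where pkm: "p = (k, m)" by (cases p)
      have km: "odd (gcd k m)" "0 < m" "m < k" "real_of_int k \<le> B" "Q k"
        using p by (auto simp: pkm odd_gcd_pairs_def)
      define g where "g = gcd k m"
      have g0: "g > 0" using km by (simp add: g_def)
      obtain k' m' where k': "k = g * k'" and m': "m = g * m'" and cop: "coprime k' m'"
        using gcd_coprime_exists[of k m] km unfolding g_def by (metis gcd_eq_0_iff less_irrefl mult.commute)
      define j where "j = nat (g div 2)"
      have gj: "g = 2 * int j + 1" using km(1) g0 unfolding j_def g_def by (auto elim!: oddE)
      have "g \<le> m" using km(2) unfolding g_def by (simp add: zdvd_imp_le)
      then have "real_of_int g < B" using km by linarith
      then have jM: "j < M" using M gj by simp
      have "m' > 0" "m' < k'" using km g0 by (auto simp: k' m' zero_less_mult_iff)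
      moreover have "real_of_int k' \<le> B / (2 * real j + 1)"
        using km(4) gj by (simp add: k' pos_le_divide_eq mult.commute)
      moreover have "Q k'" using km(1,5) Q[of g k'] unfolding k' by (metis g_def k')
      ultimately have "(k', m') \<in> S j" using cop by (simp add: S_def P_set_def)
      then show "p \<in> f ` (SIGMA j:{..<M}. S j)"
        using jM by (intro image_eqI[of _ _ "(j, k', m')"]) (auto simp: f_def pkm k' m' gj)
    qed
  qed
  then have "card {p \<in> odd_gcd_pairs B. Q (fst p)} = card (SIGMA j:{..<M}. S j)"
    by (rule bij_betw_same_card [symmetric])
  also have "\<dots> = (\<Sum>j<M. card (S j))"
    by (rule card_SigmaI) (auto simp: S_def intro: finite_subset[OF _ finite_P_set])
  finally show ?thesis by (simp add: S_def)
qed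

section \<open>Counting pairs with odd greatest common divisor\<close>

lemma card_odd_less_even:
  fixes k :: int
  assumes "even k"
  shows "card {m. 0 < m \<and> m < k \<and> odd m} = nat (k div 2)"
proof -
  have "{m. 0 < m \<and> m < k \<and> odd m} = (\<lambda>i. 2 * i + 1) ` {0..<k div 2}"
    using assms by (auto simp: image_iff elim!: evenE oddE) presburger
  then show ?thesis by (simp add: card_image inj_on_def)
qed

text \<open>
  Over a fixed \<open>k\<close> there are \<open>k / 2\<close> admissible values of \<open>m\<close> if \<open>k\<close> is even (the odd ones) and
  \<open>k - 1\<close> if \<open>k\<close> is odd (all of them). Thus \<open>k\<close> contributes \<open>k\<close> or \<open>-(k - 1)\<close> to three times the
  even count minus the total. These terms, 0, 2, -2, 4, -4 and so on, cancel in pairs, so the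
  difference never exceeds \<open>n\<close>.
\<close>

lemma card_odd_gcd_pairs:
  assumes "n = nat \<lfloor>B\<rfloor>"
  shows "8 * real (card (odd_gcd_pairs B)) =
           3 * real n ^ 2 - (if even n then 2 * real n else 3)" (is ?total)
    and "3 * real (card {p \<in> odd_gcd_pairs B. even (fst p)}) =
           real (card (odd_gcd_pairs B)) + (if even n then real n else 0)" (is ?even)
proof -
  define R :: "nat \<Rightarrow> int set" where
    "R k = {m. odd (gcd (int k) m) \<and> 0 < m \<and> m < int k}" for k
  have finR: "finite (R k)" for k by (rule finite_subset[of _ "{0..int k}"]) (auto simp: R_def)
  have R_even: "card (R k) = k div 2" if "even k" for k
    using card_odd_less_even[of "int k"] that by (simp add: R_def conj_commute conj_left_commute nat_div_distrib)
  have R_odd: "card (R k) = k - 1" if "odd k" for k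
  proof -
    have "R k = {0<..<int k}" using that by (auto simp: R_def)
    then show ?thesis by simp
  qed
  have R_Suc: "real (card (R (Suc n))) = (if even n then real n else (real n + 1) / 2)" for n
    using R_even[of "Suc n"] R_odd[of "Suc n"] by (auto elim!: oddE)
  have le_n: "real k \<le> B" if "k \<le> n" "0 < m" "m < int k" for k m
    using that unfolding assms by linarith
  have slices: "card {p \<in> odd_gcd_pairs B. Q (fst p)} = (\<Sum>k\<in>{k. k \<le> n \<and> Q (int k)}. card (R k))"
    for Q :: "int \<Rightarrow> bool"
  proof -
    have "bij_betw (\<lambda>(k, m). (int k, m)) (SIGMA k:{k. k \<le> n \<and> Q (int k)}. R k)
            {p \<in> odd_gcd_pairs B. Q (fst p)}"
    proof (rule bij_betw_byWitness[where f' = "\<lambda>(k, m). (nat k, m)"])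
      show "(\<lambda>(k, m). (int k, m)) ` (SIGMA k:{k. k \<le> n \<and> Q (int k)}. R k)
              \<subseteq> {p \<in> odd_gcd_pairs B. Q (fst p)}"
        using le_n by (auto simp: odd_gcd_pairs_def R_def)
      show "(\<lambda>(k, m). (nat k, m)) ` {p \<in> odd_gcd_pairs B. Q (fst p)}
              \<subseteq> (SIGMA k:{k. k \<le> n \<and> Q (int k)}. R k)"
      proof (rule image_subsetI)
        fix p assume "p \<in> {p \<in> odd_gcd_pairs B. Q (fst p)}"
        moreover obtain k m where p: "p = (k, m)" by (cases p)
        ultimately have km: "odd (gcd k m)" "0 < m" "m < k" "real_of_int k \<le> B" "Q k"
          by (auto simp: odd_gcd_pairs_def)
        then have "nat k \<le> n" unfolding assms by (intro nat_mono) (simp add: le_floor_iff)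
        moreover have "int (nat k) = k" using km by simp
        ultimately show "(case p of (k, m) \<Rightarrow> (nat k, m)) \<in> (SIGMA k:{k. k \<le> n \<and> Q (int k)}. R k)"
          using km by (simp only: p R_def mem_Sigma_iff mem_Collect_eq prod.case) simp
      qed
    qed (auto simp: odd_gcd_pairs_def)
    then have "card {p \<in> odd_gcd_pairs B. Q (fst p)} = card (SIGMA k:{k. k \<le> n \<and> Q (int k)}. R k)"
      by (rule bij_betw_same_card [symmetric])
    also have "\<dots> = (\<Sum>k\<in>{k. k \<le> n \<and> Q (int k)}. card (R k))"
      by (rule card_SigmaI) (auto simp: finR)
    finally show ?thesis .
  qed
  have total: "real (card (odd_gcd_pairs B)) = (\<Sum>k\<le>n. real (card (R k)))"
    using slices[of "\<lambda>_. True"] by (simp add: atMost_def)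
  have "real (card {p \<in> odd_gcd_pairs B. even (fst p)}) = (\<Sum>k\<in>{..n} \<inter> {k. even k}. real (card (R k)))"
    using slices[of even] by (simp add: atMost_def Collect_conj_eq)
  also have "\<dots> = (\<Sum>k\<le>n. if even k then real (card (R k)) else 0)"
    by (subst sum.inter_restrict) auto
  finally have even: "real (card {p \<in> odd_gcd_pairs B. even (fst p)}) = \<dots>" .
  have "8 * (\<Sum>k\<le>n. real (card (R k))) = 3 * real n ^ 2 - (if even n then 2 * real n else 3)" for n
  proof (induction n)
    case 0
    show ?case by (simp add: R_even)
  next
    case (Suc n)
    then show ?case using R_Suc[of n] by (auto simp: power2_eq_square field_simps)
  qed
  then show ?total by (simp add: total)
  have "3 * (\<Sum>k\<le>n. if even k then real (card (R k)) else 0) =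
          (\<Sum>k\<le>n. real (card (R k))) + (if even n then real n else 0)" for n
  proof (induction n)
    case 0
    show ?case by (simp add: R_even)
  next
    case (Suc n)
    then show ?case using R_Suc[of n] by (auto simp: field_simps)
  qed
  then show ?even by (simp add: total even)
qed

section \<open>The contraction constant\<close>

text \<open>
  The exponent \<open>3/2\<close> lies between the linear error term and the quadratic main term, and is
  large enough for the sum over odd \<open>d \<ge> 3\<close> to stay below 1. By convexity \<open>d\<^sup>-\<^sup>3\<^sup>/\<^sup>2\<close> is at most half
  of the integral of \<open>x\<^sup>-\<^sup>3\<^sup>/\<^sup>2\<close> over \<open>[d - 1, d + 1]\<close>; these intervals tile \<open>[2, \<infinity>)\<close>, and the bounds
  telescope to \<open>1/\<surd>2\<close>.
\<close>

lemma sum_odd_inverse_three_halves_le: "(\<Sum>j<M. 1 / ((2 * real j + 3) * sqrt (2 * real j + 3))) \<le> 3 / 4"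
proof -
  have step: "1 / (d * sqrt d) \<le> 1 / sqrt (d - 1) - 1 / sqrt (d + 1)" if "d > 1" for d :: real
  proof -
    define a b where "a = sqrt (d - 1)" and "b = sqrt (d + 1)"
    have pos: "a > 0" "b > 0" using that by (auto simp: a_def b_def)
    have sq: "a ^ 2 = d - 1" "b ^ 2 = d + 1" using that by (auto simp: a_def b_def)
    have "a * b = sqrt (d ^ 2 - 1)"
      by (simp add: a_def b_def real_sqrt_mult [symmetric] power2_eq_square algebra_simps)
    also have "\<dots> \<le> sqrt (d ^ 2)" by (rule real_sqrt_le_mono) simp
    finally have ab: "a * b \<le> d" using that by simp
    have "(a + b) ^ 2 \<le> 2 * a ^ 2 + 2 * b ^ 2"
      using zero_le_power2[of "a - b"] by (simp add: power2_eq_square algebra_simps)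
    also have "\<dots> = (2 * sqrt d) ^ 2" using that by (simp add: sq power_mult_distrib)
    finally have "a + b \<le> 2 * sqrt d" by (rule power2_le_imp_le) (use that in simp)
    then have le: "(a * b) * (a + b) \<le> d * (2 * sqrt d)" using ab pos that by (intro mult_mono) auto
    (* Rationalising the difference of reciprocals reduces the claim to le. *)
    have "(b - a) * (a + b) = 2" using sq by (simp add: power2_eq_square algebra_simps)
    then have "2 / ((a * b) * (a + b)) = (b - a) / (a * b)"
      using pos by (metis add_pos_pos less_irrefl nonzero_mult_divide_mult_cancel_right)
    also have "\<dots> = 1 / a - 1 / b" using pos by (simp add: diff_divide_distrib)
    finally have "1 / a - 1 / b = 2 / ((a * b) * (a + b))" by (rule sym)
    also have "\<dots> \<ge> 2 / (d * (2 * sqrt d))" using le pos that by (intro divide_left_mono) auto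
    finally show ?thesis using that by (simp add: a_def b_def)
  qed
  have "(\<Sum>j<M. 1 / ((2 * real j + 3) * sqrt (2 * real j + 3))) \<le> 1 / sqrt 2 - 1 / sqrt (2 * real M + 2)"
  proof (induction M)
    case (Suc M)
    then show ?case using step[of "2 * real M + 3"] by (simp add: add.commute)
  qed simp
  also have "\<dots> \<le> 1 / sqrt 2" by simp
  also have "\<dots> \<le> 3 / 4"
  proof -
    have "4 / 3 \<le> sqrt (2::real)" by (rule real_le_rsqrt) (simp add: power2_eq_square)
    then show ?thesis by (simp add: field_simps)
  qed
  finally show ?thesis .
qed

section \<open>The recursion for coprime pairs\<close>

lemma G3_set_eq: "G3_set B = {p \<in> P_set B. even (fst p)}"
proof -
  have "odd m" if "gcd k m = 1" "even k" for k m :: int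
    using that by (metis gcd_greatest odd_one)
  then show ?thesis
    by (auto simp: G3_set_def P_set_def cong_def odd_iff_mod_2_eq_one even_iff_mod_2_eq_zero)
qed

lemma P_set_subset: "P_set B \<subseteq> odd_gcd_pairs B"
  by (auto simp: P_set_def odd_gcd_pairs_def)

lemma finite_odd_gcd_pairs: "finite (odd_gcd_pairs B)"
  by (rule finite_subset[of _ "{0..\<lfloor>B\<rfloor>} \<times> {0..\<lfloor>B\<rfloor>}"]) (auto simp: odd_gcd_pairs_def le_floor_iff)

lemma odd_gcd_pairs_bounds:
  assumes "B \<ge> 0"
  shows "real (card (odd_gcd_pairs B)) \<le> 3 / 8 * B ^ 2"
    and "real (card (odd_gcd_pairs B)) \<ge> 3 / 8 * B ^ 2 - 5 / 4 * B"
    and "\<bar>3 * real (card {p \<in> odd_gcd_pairs B. even (fst p)}) - real (card (odd_gcd_pairs B))\<bar> \<le> B"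
proof -
  define n where "n = nat \<lfloor>B\<rfloor>"
  have n: "real n \<le> B" "B < real n + 1" using assms unfolding n_def by linarith+
  have "real n ^ 2 \<le> B ^ 2" using n by (intro power_mono) auto
  then show "real (card (odd_gcd_pairs B)) \<le> 3 / 8 * B ^ 2"
    using card_odd_gcd_pairs(1)[OF n_def] by (auto split: if_splits)
  show "\<bar>3 * real (card {p \<in> odd_gcd_pairs B. even (fst p)}) - real (card (odd_gcd_pairs B))\<bar> \<le> B"
    using card_odd_gcd_pairs(2)[OF n_def] n assms by auto
  show "real (card (odd_gcd_pairs B)) \<ge> 3 / 8 * B ^ 2 - 5 / 4 * B"
  proof (cases "n = 0")
    case True
    then have "B * B \<le> B * 1" using n assms by (intro mult_left_mono) auto
    then have "3 / 8 * B ^ 2 - 5 / 4 * B \<le> 0" using assms by (simp add: power2_eq_square)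
    then show ?thesis by linarith
  next
    case False
    then have "B \<ge> 1" using n by linarith
    then have "(B - 1) ^ 2 \<le> real n ^ 2" using n by (intro power_mono) auto
    then have "B ^ 2 - 2 * B + 1 \<le> real n ^ 2" by (simp add: power2_eq_square algebra_simps)
    then show ?thesis using card_odd_gcd_pairs(1)[OF n_def] n \<open>B \<ge> 1\<close>
      by (auto split: if_splits)
  qed
qed

text \<open>The function \<open>h\<close> of the introduction; the theorem says that it is of smaller order than \<open>B\<^sup>2\<close>.\<close>

definition defect :: "real \<Rightarrow> real" where
  "defect B = 3 * real (card (G3_set B)) - real (card (P_set B))"

lemma odd_gcd_sum_P_set:
  assumes "B \<le> 2 * real M"
  shows "real (card (odd_gcd_pairs B)) = (\<Sum>j<M. real (card (P_set (B / (2 * real j + 1)))))"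
  using card_odd_gcd_pairs_by_gcd[of "\<lambda>_. True" B M] assms by simp

lemma odd_gcd_sum_defect:
  assumes "B \<le> 2 * real M"
  shows "3 * real (card {p \<in> odd_gcd_pairs B. even (fst p)}) - real (card (odd_gcd_pairs B))
    = (\<Sum>j<M. defect (B / (2 * real j + 1)))"
  using card_odd_gcd_pairs_by_gcd[of even B M] odd_gcd_sum_P_set[of B M] assms
  by (simp add: defect_def G3_set_eq sum_subtractf sum_distrib_left)

lemma sum_odd_split:
  fixes F :: "real \<Rightarrow> real"
  shows "(\<Sum>j<Suc M. F (B / (2 * real j + 1))) = F B + (\<Sum>j<M. F (B / (2 * real j + 3)))"
proof -
  have "2 * real (Suc j) + 1 = 2 * real j + 3" for j by simp
  then show ?thesis by (simp only: sum.lessThan_Suc_shift) simp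
qed

text \<open>
  Write \<open>h\<close> for the defect. With the bound \<open>A B\<^sup>3\<^sup>/\<^sup>2\<close> assumed at every \<open>B / d\<close>, the recursion gives
  \<open>|h(B)| \<le> B + (3/4) A B\<^sup>3\<^sup>/\<^sup>2 \<le> (1 + (3/4) A) B\<^sup>3\<^sup>/\<^sup>2\<close> for \<open>B \<ge> 1\<close>, and \<open>A = 4\<close> is the least constant with
  \<open>1 + (3/4) A \<le> A\<close>. The induction is well-founded because \<open>B / 3\<close> is below the integer
  part of \<open>B\<close> as soon as \<open>B \<ge> 1\<close>.
\<close>

lemma abs_defect_le:
  assumes "B \<ge> 0"
  shows "\<bar>defect B\<bar> \<le> 4 * (B * sqrt B)"
  using assms
proof (induction "nat \<lfloor>B\<rfloor>" arbitrary: B rule: less_induct)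
  case less
  show ?case
  proof (cases "B < 1")
    case True
    then have "P_set B = {}" by (auto simp: P_set_def)
    then show ?thesis using less.prems by (simp add: defect_def G3_set_eq)
  next
    case False
    then have B: "B \<ge> 1" by simp
    obtain M :: nat where M: "B \<le> real M" using real_arch_simple by blast
    let ?S = "\<Sum>j<M. defect (B / (2 * real j + 3))"
    have "defect B + ?S = 3 * real (card {p \<in> odd_gcd_pairs B. even (fst p)}) - real (card (odd_gcd_pairs B))"
      using odd_gcd_sum_defect[of B "Suc M"] M sum_odd_split[of defect B M] by simp
    then have total: "\<bar>defect B + ?S\<bar> \<le> B" using odd_gcd_pairs_bounds(3)[of B] B by simp
    have "\<bar>?S\<bar> \<le> (\<Sum>j<M. \<bar>defect (B / (2 * real j + 3))\<bar>)" by (rule sum_abs)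
    also have "\<dots> \<le> (\<Sum>j<M. 4 * (B * sqrt B) * (1 / ((2 * real j + 3) * sqrt (2 * real j + 3))))"
    proof (rule sum_mono)
      fix j
      have "B / (2 * real j + 3) \<le> B / 3" using B by (intro divide_left_mono) auto
      moreover have "real_of_int \<lfloor>B\<rfloor> \<ge> 1" using B by simp
      moreover have "B < real_of_int \<lfloor>B\<rfloor> + 1" by simp
      ultimately have "B / (2 * real j + 3) < real_of_int \<lfloor>B\<rfloor>" by linarith
      then have "nat \<lfloor>B / (2 * real j + 3)\<rfloor> < nat \<lfloor>B\<rfloor>"
        using B by (simp add: floor_less_iff nat_less_eq_zless)
      from less.hyps[OF this] B
      show "\<bar>defect (B / (2 * real j + 3))\<bar>
          \<le> 4 * (B * sqrt B) * (1 / ((2 * real j + 3) * sqrt (2 * real j + 3)))"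
        by (simp add: real_sqrt_divide)
    qed
    also have "\<dots> = 4 * (B * sqrt B) * (\<Sum>j<M. 1 / ((2 * real j + 3) * sqrt (2 * real j + 3)))"
      by (simp add: sum_distrib_left)
    also have "\<dots> \<le> 4 * (B * sqrt B) * (3 / 4)"
      using B by (intro mult_left_mono sum_odd_inverse_three_halves_le) auto
    finally have "\<bar>?S\<bar> \<le> 3 * (B * sqrt B)" by simp
    moreover have "B * 1 \<le> B * sqrt B" using B by (intro mult_left_mono) auto
    ultimately show ?thesis using total by linarith
  qed
qed

text \<open>
  The pairs with gcd \<open>d\<close> number at most \<open>(3/8) (B/d)\<^sup>2\<close>. Summed over odd \<open>d \<ge> 3\<close> this is at most
  three quarters of \<open>(3/8) B\<^sup>2\<close>, the leading term of the count of all pairs with odd gcd, which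
  leaves \<open>(3/32) B\<^sup>2\<close> for the coprime ones. Bounding \<open>d\<^sup>-\<^sup>2\<close> by \<open>d\<^sup>-\<^sup>3\<^sup>/\<^sup>2\<close> is wasteful but sufficient, and
  from \<open>B = 40\<close> on the linear error \<open>(5/4) B\<close> is absorbed by \<open>B\<^sup>2 / 32\<close>.
\<close>

lemma card_P_set_ge:
  assumes "B \<ge> 40"
  shows "real (card (P_set B)) \<ge> B ^ 2 / 16"
proof -
  obtain M :: nat where M: "B \<le> real M" using real_arch_simple by blast
  let ?S = "\<Sum>j<M. real (card (P_set (B / (2 * real j + 3))))"
  have eq: "real (card (odd_gcd_pairs B)) = real (card (P_set B)) + ?S"
    using odd_gcd_sum_P_set[of B "Suc M"] M sum_odd_split[of "\<lambda>x. real (card (P_set x))" B M] by simp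
  have "?S \<le> (\<Sum>j<M. 3 / 8 * B ^ 2 * (1 / ((2 * real j + 3) * sqrt (2 * real j + 3))))"
  proof (rule sum_mono)
    fix j
    define d where "d = 2 * real j + 3"
    have d: "d \<ge> 3" by (simp add: d_def)
    have "sqrt d \<le> d" using d by (intro real_le_lsqrt) (auto simp: power2_eq_square)
    then have "1 / d ^ 2 \<le> 1 / (d * sqrt d)"
      unfolding power2_eq_square using d by (intro divide_left_mono mult_left_mono) auto
    then have "3 / 8 * B ^ 2 * (1 / d ^ 2) \<le> 3 / 8 * B ^ 2 * (1 / (d * sqrt d))"
      by (intro mult_left_mono) auto
    moreover have "real (card (P_set (B / d))) \<le> 3 / 8 * (B / d) ^ 2"
    proof -
      have "card (P_set (B / d)) \<le> card (odd_gcd_pairs (B / d))"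
        by (intro card_mono finite_odd_gcd_pairs P_set_subset)
      then show ?thesis using odd_gcd_pairs_bounds(1)[of "B / d"] d assms by simp
    qed
    ultimately show "real (card (P_set (B / (2 * real j + 3))))
        \<le> 3 / 8 * B ^ 2 * (1 / ((2 * real j + 3) * sqrt (2 * real j + 3)))"
      unfolding d_def by (simp add: power_divide)
  qed
  also have "\<dots> = 3 / 8 * B ^ 2 * (\<Sum>j<M. 1 / ((2 * real j + 3) * sqrt (2 * real j + 3)))"
    by (simp add: sum_distrib_left)
  also have "\<dots> \<le> 3 / 8 * B ^ 2 * (3 / 4)"
    by (intro mult_left_mono sum_odd_inverse_three_halves_le) auto
  finally have "real (card (P_set B)) \<ge> 3 / 32 * B ^ 2 - 5 / 4 * B"
    using eq odd_gcd_pairs_bounds(2)[of B] assms by simp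
  moreover have "40 * B \<le> B ^ 2" using assms by (simp add: power2_eq_square)
  ultimately show ?thesis by simp
qed

section \<open>The limit\<close>

theorem theorem4p9:
  shows "((\<lambda>B::real. real (card (G3_set B)) / real (card (P_set B))) \<longlongrightarrow> 1 / 3) at_top"
proof -
  have "((\<lambda>B. real (card (G3_set B)) / real (card (P_set B)) - 1 / 3) \<longlongrightarrow> 0) at_top"
  proof (rule tendsto_0_le[where K = 1])
    show "\<forall>\<^sub>F B in at_top. norm (real (card (G3_set B)) / real (card (P_set B)) - 1 / 3) \<le> norm (64 / 3 / sqrt B) * 1"
    proof (rule eventually_mono[OF eventually_ge_at_top[of 40]])
      fix B :: real assume B: "40 \<le> B"
      define p where "p = real (card (P_set B))"
      have p: "p \<ge> B ^ 2 / 16" using card_P_set_ge[OF B] by (simp add: p_def)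
      moreover have "B ^ 2 / 16 > 0" using B by simp
      ultimately have p0: "p > 0" by linarith
      have "real (card (G3_set B)) / p - 1 / 3 = defect B / (3 * p)"
        using p0 by (simp add: defect_def p_def field_simps)
      then have "norm (real (card (G3_set B)) / p - 1 / 3) = \<bar>defect B\<bar> / (3 * p)"
        using p0 by (simp add: abs_divide)
      also have "\<dots> \<le> 4 * (B * sqrt B) / (3 * (B ^ 2 / 16))"
        using abs_defect_le[of B] p B by (intro frac_le) auto
      also have "\<dots> = 64 / 3 / sqrt B"
      proof -
        (* Working with the square root as the variable makes both sides rational functions. *)
        define s where "s = sqrt B"
        have "s > 0" "B = s ^ 2" using B by (auto simp: s_def)
        then show ?thesis unfolding s_def[symmetric] by (simp add: field_simps power2_eq_square)
      qed
      finally show "norm (real (card (G3_set B)) / real (card (P_set B)) - 1 / 3) \<le> norm (64 / 3 / sqrt B) * 1"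
        using B by (simp add: p_def)
    qed
    show "((\<lambda>B. 64 / 3 / sqrt B) \<longlongrightarrow> 0) at_top"
      by (intro tendsto_divide_0[OF tendsto_const] filterlim_at_top_imp_at_infinity sqrt_at_top)
  qed
  then show ?thesis by (simp add: LIM_zero_iff)
qed

end
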